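(* Let $A<0$ and suppose that $g(x)$ is a strictly positive, continuous and strictly increasing cumulative distribution function on $(-\infty, A]$. Suppose further that some real-valued function $y(u)$ with $y(u)\to-\infty$ as $u\to 0^+$ satisfies $$y(g(x)) = x\left(1+O(\zeta(x))\right)\quad\text{as } x\to-\infty,$$ where $\zeta(x)\to 0$ as $x\to-\infty$. Suppose finally that $\zeta(x)=\psi\left(-\frac{1}{x}\right)$ with $$\psi(w)=w^{\rho}L(w)$$ for some constant $\rho\ge 0$ and some function $L(w)$, $w>0$, slowly varying at $0$. If $h(u)$, $u\in(0,g(A)]$, is the inverse function of $g$, then $$h(u)=y(u)\left(1+O(\zeta(y(u)))\right)\quad\text{as } u\to 0^+.$$
   Context: "Cumulative distribution function on $(-\infty,A]$" means that $g$ is the restriction to $(-\infty,A]$ of the cumulative distribution function of a real random variable; in particular $g(x)\to 0$ as $x\to-\infty$. The function $y(u)$ is defined for small $u>0$. A function $L$ is slowly varying at $0$ if it is positive and measurable on $(0,\delta)$ for some $\delta>0$ and $\lim_{w\to0^+}L(\lambda w)/L(w)=1$ for every $\lambda>0$. The notation $y(g(x))=x(1+O(\zeta(x)))$ as $x\to-\infty$ means that $|y(g(x))/x-1|\le C|\zeta(x)|$ for some constant $C$ and all sufficiently negative $x$; similarly, $h(u)=y(u)(1+O(\zeta(y(u))))$ as $u\to0^+$ means that $|h(u)/y(u)-1|\le C'|\zeta(y(u))|$ for some constant $C'$ and all sufficiently small $u>0$. *)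

theory Defs
  imports "HOL-Probability.Probability" "HOL-Library.Landau_Symbols"
begin

definition cdf_up_to :: "real \<Rightarrow> (real \<Rightarrow> real) \<Rightarrow> bool" where
  "cdf_up_to A g \<longleftrightarrow> (\<exists>M. real_distribution M \<and> (\<forall>x\<le>A. g x = cdf M x))"

(* Measurability is Lebesgue measurability, which includes the Borel case. *)
definition slowly_varying_at_0 :: "(real \<Rightarrow> real) \<Rightarrow> bool" where
  "slowly_varying_at_0 L \<longleftrightarrow>
     (\<exists>\<delta>>0. (\<forall>w\<in>{0<..<\<delta>}. L w > 0) \<and> L \<in> borel_measurable (lebesgue_on {0<..<\<delta>})) \<and>
     (\<forall>c>0. ((\<lambda>w. L (c * w) / L w) \<longlongrightarrow> 1) (at_right 0))"

end

theory Submission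
  imports Defs
begin

text \<open>
  Put \<open>x = h u\<close>, so that \<open>u = g x\<close>. As \<open>g\<close> is positive, continuous and tends to \<open>0\<close> at
  \<open>-\<infinity>\<close>, every small \<open>u > 0\<close> is a value of \<open>g\<close>, and \<open>x \<rightarrow> -\<infinity>\<close> as \<open>u \<rightarrow> 0\<close>. The hypothesis then says
  \<open>y u / x = 1 + O(\<zeta> x)\<close>. Since \<open>\<zeta> x \<rightarrow> 0\<close> this ratio tends to \<open>1\<close>, so taking reciprocals gives
  \<open>x / y u = 1 + O(\<zeta> x)\<close>. What is left is to replace \<open>\<zeta> x\<close> by \<open>\<zeta> (y u)\<close>, that is,
  to see that \<open>\<zeta>\<close> changes by at most a constant factor when its argument is multiplied by
  a factor close to \<open>1\<close>.

  The power \<open>w powr \<rho>\<close> is harmless there. For \<open>L\<close> one needs a bound on \<open>L (c w) / L w\<close> that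
  is uniform in \<open>c\<close>, since the factor \<open>c = y u / x\<close> varies with \<open>u\<close>, while slow variation is a
  statement about each fixed \<open>c\<close>. A full uniform convergence theorem is more than is required: a bound
  \<open>L (c w) \<le> 3 L w\<close> for \<open>c\<close> in a compact interval suffices
  (\<open>slowly_varying_locally_uniform_bound\<close>). It comes from measurability. For small \<open>w\<close> the set
  of \<open>\<mu>\<close> for which \<open>L (\<mu> w) / L w\<close> is not close to \<open>1\<close> has small measure
  (\<open>slowly_varying_convergence_in_measure\<close>), and the same is true with \<open>c w\<close> in place of \<open>w\<close>.
  Hence some \<open>\<mu>\<close> makes both \<open>L (\<mu> c w) / L w\<close> and \<open>L (\<mu> c w) / L (c w)\<close> close to \<open>1\<close>,
  which compares \<open>L (c w)\<close> with \<open>L w\<close>.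
\<close>

section \<open>Local uniformity of slow variation\<close>

definition ratio_deviation_set :: "(real \<Rightarrow> real) \<Rightarrow> real \<Rightarrow> real \<Rightarrow> real \<Rightarrow> real \<Rightarrow> real set" where
  "ratio_deviation_set L \<epsilon> a b w = {\<mu>\<in>{a..b}. \<bar>L (\<mu> * w) / L w - 1\<bar> > \<epsilon>}"

lemma slowly_varying_eventually_pos:
  assumes "slowly_varying_at_0 L"
  shows "eventually (\<lambda>w. L w > 0) (at_right 0)"
proof -
  obtain \<delta> where "\<delta> > 0" "\<forall>w\<in>{0<..<\<delta>}. L w > 0"
    using assms unfolding slowly_varying_at_0_def by blast
  then show ?thesis
    unfolding eventually_at_right_field by auto
qed

lemma ratio_deviation_set_measurable:
  assumes "slowly_varying_at_0 L" "0 < a"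
  shows "eventually (\<lambda>w. ratio_deviation_set L \<epsilon> a b w \<in> sets lebesgue) (at_right 0)"
proof -
  obtain \<delta> where \<delta>: "\<delta> > 0" "L \<in> borel_measurable (lebesgue_on {0<..<\<delta>})"
    using assms unfolding slowly_varying_at_0_def by blast
  define K where "K = (\<lambda>x. indicator {0<..<\<delta>} x *\<^sub>R L x)"
  have K: "K \<in> borel_measurable lebesgue"
    using \<delta>(2) unfolding K_def by (subst (asm) borel_measurable_restrict_space_iff) auto
  have "ratio_deviation_set L \<epsilon> a b w \<in> sets lebesgue" if w: "0 < w" "w < \<delta> / (\<bar>b\<bar> + 1)" for w
  proof -
    have "(\<lambda>\<mu>. K (w *\<^sub>R \<mu>)) \<in> borel_measurable lebesgue"
      using measurable_compose[OF lebesgue_measurable_scaling K] .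
    then have "(\<lambda>\<mu>. \<bar>K (w * \<mu>) / L w - 1\<bar>) \<in> borel_measurable lebesgue"
      by simp
    then have "{\<mu> \<in> space lebesgue. \<bar>K (w * \<mu>) / L w - 1\<bar> > \<epsilon>} \<in> sets lebesgue"
      by measurable
    moreover have "K (w * \<mu>) = L (\<mu> * w)" if "\<mu> \<in> {a..b}" for \<mu>
    proof -
      have "\<mu> * w \<le> (\<bar>b\<bar> + 1) * w" using that w by (intro mult_right_mono) auto
      also have "\<dots> < \<delta>" using w by (simp add: field_simps)
      finally show ?thesis using that w \<open>0 < a\<close> by (simp add: K_def mult.commute)
    qed
    then have "ratio_deviation_set L \<epsilon> a b w =
        {a..b} \<inter> {\<mu> \<in> space lebesgue. \<bar>K (w * \<mu>) / L w - 1\<bar> > \<epsilon>}"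
      by (auto simp: ratio_deviation_set_def)
    ultimately show ?thesis by auto
  qed
  moreover have "0 < \<delta> / (\<bar>b\<bar> + 1)" using \<delta> by simp
  ultimately show ?thesis
    unfolding eventually_at_right_field by blast
qed

text \<open>
  For fixed \<open>\<mu>\<close> slow variation keeps \<open>\<mu>\<close> out of the deviation set as soon as \<open>w\<close> is small.
  Dominated convergence for the indicators turns this pointwise fact into smallness of the
  measure; here the measurability of \<open>L\<close> enters.
\<close>
lemma slowly_varying_convergence_in_measure:
  assumes sv: "slowly_varying_at_0 L" and "0 < a" "0 < \<epsilon>"
  shows "((\<lambda>w. measure lebesgue (ratio_deviation_set L \<epsilon> a b w)) \<longlongrightarrow> 0) (at_right 0)"
proof -
  obtain d where d: "0 < d"
      "\<And>w. 0 < w \<Longrightarrow> w < d \<Longrightarrow> ratio_deviation_set L \<epsilon> a b w \<in> sets lebesgue"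
    using ratio_deviation_set_measurable[OF sv \<open>0 < a\<close>, of \<epsilon> b]
    unfolding eventually_at_right_field by auto
  show ?thesis
  proof (rule tendsto_at_right_sequentially[OF \<open>0 < d\<close>])
    fix S :: "nat \<Rightarrow> real"
    assume S: "\<And>n. 0 < S n" "\<And>n. S n < d" "S \<longlonglongrightarrow> 0"
    let ?E = "\<lambda>n. ratio_deviation_set L \<epsilon> a b (S n)"
    have S_right: "filterlim S (at_right 0) sequentially"
      using S by (auto simp: filterlim_at intro!: always_eventually less_imp_neq[symmetric])
    have E: "?E n \<in> sets lebesgue" for n using d S by auto
    have "(\<lambda>n. indicator (?E n) \<mu> :: real) \<longlonglongrightarrow> 0" for \<mu>
    proof (cases "\<mu> \<in> {a..b}")
      case True
      have "((\<lambda>w. L (\<mu> * w) / L w) \<longlongrightarrow> 1) (at_right 0)"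
        using sv True \<open>0 < a\<close> unfolding slowly_varying_at_0_def by auto
      then have "(\<lambda>n. L (\<mu> * S n) / L (S n)) \<longlonglongrightarrow> 1"
        using S_right by (rule filterlim_compose)
      then have "eventually (\<lambda>n. dist (L (\<mu> * S n) / L (S n)) 1 < \<epsilon>) sequentially"
        using \<open>0 < \<epsilon>\<close> by (rule tendstoD)
      then have "eventually (\<lambda>n. indicator (?E n) \<mu> = (0::real)) sequentially"
        by eventually_elim (auto simp: ratio_deviation_set_def dist_real_def)
      then show ?thesis by (rule tendsto_eventually)
    next
      case False
      then have "\<mu> \<notin> ?E n" for n by (auto simp: ratio_deviation_set_def)
      then show ?thesis by simp
    qed
    then have lim: "AE \<mu> in lebesgue. (\<lambda>n. indicator (?E n) \<mu> :: real) \<longlonglongrightarrow> 0"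
      by simp
    have "(\<lambda>n. integral\<^sup>L lebesgue (indicator (?E n) :: real \<Rightarrow> real)) \<longlonglongrightarrow>
        integral\<^sup>L lebesgue (\<lambda>_ :: real. 0 :: real)"
    proof (rule integral_dominated_convergence[OF _ _ _ lim])
      show "integrable lebesgue (indicator {a..b} :: real \<Rightarrow> real)"
        by (intro integrable_real_indicator) (auto simp: emeasure_lborel_Icc_eq)
      show "AE \<mu> in lebesgue. norm (indicator (?E n) \<mu> :: real) \<le> indicator {a..b} \<mu>" for n
        by (intro AE_I2) (auto simp: ratio_deviation_set_def indicator_def)
    qed (use E in auto)
    then show "(\<lambda>n. measure lebesgue (?E n)) \<longlonglongrightarrow> 0"
      by simp
  qed
qed

text \<open>
  The factor \<open>\<mu>\<close> below ranges over an interval of length \<open>1\<close>. It must avoid the deviation set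
  at \<open>c w\<close> and the deviation set at \<open>w\<close> shrunk by \<open>c\<close>; once these have measure below
  \<open>1 / 2\<close> each, they cannot cover the interval. Shrinking by \<open>c\<close> divides the measure by
  \<open>c \<ge> a\<close>, whence the threshold \<open>a / 2\<close> for the set at \<open>w\<close>. A deviation of at most \<open>1 / 2\<close>
  at both places gives \<open>L (c w) / 2 \<le> L (\<mu> c w) \<le> 3 / 2 * L w\<close>.
\<close>
lemma slowly_varying_locally_uniform_bound:
  assumes sv: "slowly_varying_at_0 L" and a: "0 < a"
  shows "eventually (\<lambda>w. \<forall>c\<in>{a..b}. L (c * w) \<le> 3 * L w) (at_right 0)"
proof (cases "a \<le> b")
  case True
  then have b: "0 < b" using a by simp
  let ?E = "\<lambda>w. ratio_deviation_set L (1/2) a (2 * b) w"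
  let ?F = "\<lambda>w. ratio_deviation_set L (1/2) 1 2 w"
  have meas_E: "eventually (\<lambda>w. measure lebesgue (?E w) < a / 2) (at_right 0)"
    using a by (intro order_tendstoD(2)[OF slowly_varying_convergence_in_measure[OF sv a]]) auto
  have "eventually (\<lambda>w. measure lebesgue (?F w) < 1 / 2) (at_right 0)"
    by (intro order_tendstoD(2)[OF slowly_varying_convergence_in_measure[OF sv]]) auto
  then have "eventually (\<lambda>w. ?F w \<in> sets lebesgue \<and> measure lebesgue (?F w) < 1 / 2 \<and> L w > 0)
      (at_right 0)"
    using ratio_deviation_set_measurable[OF sv, of 1 "1/2" 2] slowly_varying_eventually_pos[OF sv]
    by (simp add: eventually_conj_iff)
  then obtain d where d: "0 < d" "\<And>v. 0 < v \<Longrightarrow> v < d \<Longrightarrow>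
      ?F v \<in> sets lebesgue \<and> measure lebesgue (?F v) < 1 / 2 \<and> L v > 0"
    unfolding eventually_at_right_field by auto
  have "eventually (\<lambda>w. w < d / b) (at_right 0)" "eventually (\<lambda>w::real. 0 < w) (at_right 0)"
    using d b by (auto intro: eventually_at_right_less order_tendstoD(2)[OF tendsto_ident_at])
  with meas_E ratio_deviation_set_measurable[OF sv a, of "1/2" "2 * b"]
    slowly_varying_eventually_pos[OF sv]
  show ?thesis
  proof eventually_elim
    case (elim w)
    show ?case
    proof
      fix c assume c: "c \<in> {a..b}"
      then have "0 < c" using a by simp
      have "c * w \<le> b * w" using c elim by (intro mult_right_mono) auto
      also have "\<dots> < d" using elim b by (simp add: field_simps)
      finally have F: "?F (c * w) \<in> sets lebesgue" "measure lebesgue (?F (c * w)) < 1 / 2"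
          "L (c * w) > 0"
        using d \<open>0 < c\<close> elim by auto
      let ?G = "(\<lambda>\<mu>. (1 / c) *\<^sub>R \<mu> + 0) ` ?E w"
      have "?G = (*\<^sub>R) c -` ?E w \<inter> space lebesgue"
      proof (intro equalityI subsetI)
        fix \<mu> assume "\<mu> \<in> (*\<^sub>R) c -` ?E w \<inter> space lebesgue"
        then show "\<mu> \<in> ?G"
          using \<open>0 < c\<close> by (intro image_eqI[of _ _ "c * \<mu>"]) auto
      next
        fix \<mu> assume "\<mu> \<in> ?G"
        then show "\<mu> \<in> (*\<^sub>R) c -` ?E w \<inter> space lebesgue"
          using \<open>0 < c\<close> by auto
      qed
      then have G: "?G \<in> sets lebesgue"
        using measurable_sets[OF lebesgue_measurable_scaling] elim by metis
      have "measure lebesgue ?G = measure lebesgue (?E w) / c"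
        using measure_lebesgue_affine[of "1 / c" 0 "?E w"] \<open>0 < c\<close> by simp
      also have "\<dots> < (a / 2) / c"
        using elim \<open>0 < c\<close> by (intro divide_strict_right_mono) auto
      also have "\<dots> \<le> 1 / 2" using c \<open>0 < c\<close> by (simp add: field_simps)
      finally have meas_G: "measure lebesgue ?G < 1 / 2" .
      have "\<not> {1..2} \<subseteq> ?F (c * w) \<union> ?G"
      proof
        assume cover: "{1..2} \<subseteq> ?F (c * w) \<union> ?G"
        have "?F (c * w) \<subseteq> cbox 1 2" "?G \<subseteq> cbox (a / c) (2 * b / c)"
          using \<open>0 < c\<close> by (auto simp: ratio_deviation_set_def divide_right_mono)
        then have fm: "?F (c * w) \<in> lmeasurable" "?G \<in> lmeasurable"
          using F(1) G by (blast intro: fmeasurableI2[OF lmeasurable_cbox])+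
        have "1 = measure lebesgue {1..2::real}" by simp
        also have "\<dots> \<le> measure lebesgue (?F (c * w) \<union> ?G)"
          using cover fm by (intro measure_mono_fmeasurable) (auto intro: fmeasurable.Un)
        also have "\<dots> \<le> measure lebesgue (?F (c * w)) + measure lebesgue ?G"
          using F G by (intro measure_Un_le)
        also have "\<dots> < 1" using F meas_G by simp
        finally show False by simp
      qed
      then obtain \<mu> where \<mu>: "\<mu> \<in> {1..2}" "\<mu> \<notin> ?F (c * w)" "\<mu> \<notin> ?G" by blast
      have "\<mu> * c \<notin> ?E w"
        using \<mu>(3) \<open>0 < c\<close> by (auto simp: image_iff field_simps)
      moreover have "\<mu> * c \<in> {a..2 * b}"
        using \<mu>(1) c a mult_mono[of 1 \<mu> a c] mult_mono[of \<mu> 2 c b] by auto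
      ultimately have "\<bar>L (\<mu> * c * w) / L w - 1\<bar> \<le> 1 / 2"
        by (auto simp: ratio_deviation_set_def)
      then have "L (\<mu> * c * w) / L w \<le> 3 / 2" by linarith
      then have upper: "L (\<mu> * c * w) \<le> 3 / 2 * L w"
        using elim by (simp add: pos_divide_le_eq)
      have "\<bar>L (\<mu> * (c * w)) / L (c * w) - 1\<bar> \<le> 1 / 2"
        using \<mu>(1,2) by (auto simp: ratio_deviation_set_def)
      then have "1 / 2 \<le> L (\<mu> * (c * w)) / L (c * w)" by linarith
      then have "1 / 2 * L (c * w) \<le> L (\<mu> * c * w)"
        using F by (simp add: pos_le_divide_eq mult.assoc)
      with upper show "L (c * w) \<le> 3 * L w" by simp
    qed
  qed
qed simp

lemma regularly_varying_locally_uniform_bound: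
  assumes sv: "slowly_varying_at_0 L" and a: "0 < a" and \<rho>: "0 \<le> \<rho>"
  shows "eventually (\<lambda>w. \<forall>c\<in>{a..b}.
           \<bar>(c * w) powr \<rho> * L (c * w)\<bar> \<le> 3 * b powr \<rho> * \<bar>w powr \<rho> * L w\<bar>) (at_right 0)"
proof (cases "a \<le> b")
  case True
  then have b: "0 < b" using a by simp
  obtain d where d: "0 < d" "\<And>w. 0 < w \<Longrightarrow> w < d \<Longrightarrow> L w > 0"
    using slowly_varying_eventually_pos[OF sv] unfolding eventually_at_right_field by auto
  have "eventually (\<lambda>w. w < d / b) (at_right 0)" "eventually (\<lambda>w::real. 0 < w) (at_right 0)"
    using d b by (auto intro: eventually_at_right_less order_tendstoD(2)[OF tendsto_ident_at])
  with slowly_varying_locally_uniform_bound[OF sv a, of b] slowly_varying_eventually_pos[OF sv]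
  show ?thesis
  proof eventually_elim
    case (elim w)
    show ?case
    proof
      fix c assume c: "c \<in> {a..b}"
      then have "0 < c" using a by simp
      have "c * w \<le> b * w" using c elim by (intro mult_right_mono) auto
      also have "\<dots> < d" using elim b by (simp add: field_simps)
      finally have pos: "L (c * w) > 0" using d \<open>0 < c\<close> elim by auto
      have "(c * w) powr \<rho> * L (c * w) = c powr \<rho> * (w powr \<rho> * L (c * w))"
        using \<open>0 < c\<close> elim by (simp add: powr_mult)
      also have "\<dots> \<le> b powr \<rho> * (w powr \<rho> * (3 * L w))"
        using c \<open>0 < c\<close> \<rho> elim pos by (intro mult_mono powr_mono2) auto
      finally show "\<bar>(c * w) powr \<rho> * L (c * w)\<bar> \<le> 3 * b powr \<rho> * \<bar>w powr \<rho> * L w\<bar>"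
        using pos elim by (simp add: abs_mult mult_ac)
    qed
  qed
qed simp

text \<open>
  In the variable \<open>w = - 1 / z\<close> a passage from \<open>z\<close> to \<open>x\<close> multiplies by \<open>c = z / x\<close>,
  which is where the asymptotic equivalence of \<open>x\<close> and \<open>z\<close> is used.
\<close>
lemma regularly_varying_asymp_equiv_bigo:
  fixes \<psi> :: "real \<Rightarrow> real"
  assumes sv: "slowly_varying_at_0 L" and \<rho>: "0 \<le> \<rho>"
    and \<psi>: "\<And>w. 0 < w \<Longrightarrow> \<psi> w = w powr \<rho> * L w"
    and z: "filterlim z at_bot F" and ratio: "((\<lambda>u. z u / x u) \<longlongrightarrow> 1) F"
  shows "(\<lambda>u. \<psi> (- 1 / x u)) \<in> O[F](\<lambda>u. \<psi> (- 1 / z u))"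
proof (rule bigoI)
  have "filterlim (\<lambda>u. inverse (- z u)) (at_right 0) F"
    using z by (intro filterlim_compose[OF filterlim_inverse_at_right_top])
      (simp add: filterlim_uminus_at_bot)
  then have "filterlim (\<lambda>u. - 1 / z u) (at_right 0) F"
    by (simp add: inverse_eq_divide)
  then have "eventually (\<lambda>u. \<forall>c\<in>{1/2..2}. \<bar>(c * (- 1 / z u)) powr \<rho> * L (c * (- 1 / z u))\<bar>
      \<le> 3 * 2 powr \<rho> * \<bar>(- 1 / z u) powr \<rho> * L (- 1 / z u)\<bar>) F"
    by (rule eventually_compose_filterlim[OF
          regularly_varying_locally_uniform_bound[OF sv _ \<rho>, of "1/2" 2], rotated]) simp
  moreover have "eventually (\<lambda>u. 1/2 < z u / x u) F" "eventually (\<lambda>u. z u / x u < 2) F"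
    by (rule order_tendstoD[OF ratio]; simp)+
  moreover have "eventually (\<lambda>u. z u < 0) F"
    using z by (simp add: filterlim_at_bot_dense)
  ultimately show "eventually (\<lambda>u. norm (\<psi> (- 1 / x u)) \<le> 3 * 2 powr \<rho> * norm (\<psi> (- 1 / z u))) F"
  proof eventually_elim
    case (elim u)
    have "x u < 0"
    proof (rule ccontr)
      assume "\<not> x u < 0"
      then have "z u / x u \<le> 0" using elim by (intro divide_nonpos_nonneg) auto
      with elim show False by linarith
    qed
    then have eq: "z u / x u * (- 1 / z u) = - 1 / x u" using elim by simp
    have "\<bar>(- 1 / x u) powr \<rho> * L (- 1 / x u)\<bar>
        \<le> 3 * 2 powr \<rho> * \<bar>(- 1 / z u) powr \<rho> * L (- 1 / z u)\<bar>"
      using elim(1)[rule_format, of "z u / x u", unfolded eq] elim by simp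
    moreover have "0 < - 1 / x u" "0 < - 1 / z u" using \<open>x u < 0\<close> elim by (auto simp: field_simps)
    ultimately show ?case by (simp add: \<psi>)
  qed
qed

section \<open>The inverse of a distribution function near zero\<close>

lemma cdf_up_to_tendsto_0:
  assumes "cdf_up_to A g"
  shows "(g \<longlongrightarrow> 0) at_bot"
proof -
  obtain M where M: "real_distribution M" "\<forall>x\<le>A. g x = cdf M x"
    using assms unfolding cdf_up_to_def by blast
  interpret real_distribution M by fact
  have "eventually (\<lambda>x. cdf M x = g x) at_bot"
    using eventually_le_at_bot[of A] by eventually_elim (simp add: M(2))
  with cdf_lim_at_bot show ?thesis by (rule Lim_transform_eventually)
qed

text \<open>
  Far to the left \<open>g\<close> falls below any given \<open>u > 0\<close>, so the intermediate value theorem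
  yields a preimage of \<open>u < g A\<close>. Positivity of \<open>g B\<close> makes \<open>u < g B\<close> hold for all small
  \<open>u\<close>, and monotonicity then puts the preimage to the left of \<open>B\<close>.
\<close>
lemma strict_mono_inverse_at_bot:
  fixes A :: real and g :: "real \<Rightarrow> real"
  assumes lim: "(g \<longlongrightarrow> 0) at_bot" and pos: "\<And>x. x \<le> A \<Longrightarrow> 0 < g x"
    and cont: "continuous_on {..A} g" and mono: "strict_mono_on {..A} g"
  shows "eventually (\<lambda>u. g (inv_into {..A} g u) = u) (at_right 0)"
    and "filterlim (inv_into {..A} g) at_bot (at_right 0)"
proof -
  have surj: "u \<in> g ` {..A}" if u: "0 < u" "u < g A" for u
  proof -
    have "eventually (\<lambda>x. g x < u \<and> x \<le> A) at_bot"
      using order_tendstoD(2)[OF lim u(1)] eventually_le_at_bot by (rule eventually_conj)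
    then obtain x where x: "g x < u" "x \<le> A"
      using eventually_happens'[OF trivial_limit_at_bot_linorder] by blast
    have "\<exists>z\<ge>x. z \<le> A \<and> g z = u"
      using x u by (intro IVT' continuous_on_subset[OF cont]) auto
    then show ?thesis by auto
  qed
  have small: "eventually (\<lambda>u. 0 < u \<and> u < g B) (at_right 0)" if "B \<le> A" for B
    using pos[OF that] unfolding eventually_at_right_field by blast
  show "eventually (\<lambda>u. g (inv_into {..A} g u) = u) (at_right 0)"
    using small[OF order_refl] by eventually_elim (rule f_inv_into_f, rule surj, auto)
  show "filterlim (inv_into {..A} g) at_bot (at_right 0)"
    unfolding filterlim_at_bot_le[where c = A]
  proof safe
    fix B assume "B \<le> A"
    show "eventually (\<lambda>u. inv_into {..A} g u \<le> B) (at_right 0)"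
      using small[OF \<open>B \<le> A\<close>] small[OF order_refl]
    proof eventually_elim
      case (elim u)
      with surj have u: "u \<in> g ` {..A}" by auto
      show ?case
      proof (rule ccontr)
        assume "\<not> ?thesis"
        then have "g B < g (inv_into {..A} g u)"
          using mono \<open>B \<le> A\<close> inv_into_into[OF u] by (intro strict_mono_onD[OF mono]) auto
        with elim show False by (simp add: f_inv_into_f[OF u])
      qed
    qed
  qed
qed

section \<open>Inversion of the asymptotic relation\<close>

text \<open>
  This rests on \<open>1 / r - 1 = - (r - 1) / r\<close>, where \<open>1 / r\<close> is bounded because \<open>r \<rightarrow> 1\<close>.
\<close>
lemma bigo_reciprocal_minus_1:
  fixes r e :: "'a \<Rightarrow> real"
  assumes r: "(\<lambda>u. r u - 1) \<in> O[F](e)" and e: "(e \<longlongrightarrow> 0) F"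
  shows "(r \<longlongrightarrow> 1) F" and "(\<lambda>u. inverse (r u) - 1) \<in> O[F](e)"
proof -
  have "e \<in> o[F](\<lambda>_. 1)" using e by (intro smalloI_tendsto) auto
  with r have "(\<lambda>u. r u - 1) \<in> o[F](\<lambda>_. 1)" by (rule landau_o.big_small_trans)
  from smalloD_tendsto[OF this] show lim: "(r \<longlongrightarrow> 1) F"
    by (simp add: LIM_zero_iff)
  have "((\<lambda>u. inverse (r u) / 1) \<longlongrightarrow> 1) F" using tendsto_inverse[OF lim] by simp
  then have "(\<lambda>u. inverse (r u)) \<in> O[F](\<lambda>_. 1)" by (rule bigoI_tendsto) simp
  from landau_o.big.mult[OF this r]
  have "(\<lambda>u. inverse (r u) * (r u - 1)) \<in> O[F](e)" by simp
  moreover have "eventually (\<lambda>u. inverse (r u) * (r u - 1) = - (inverse (r u) - 1)) F"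
    using tendsto_imp_eventually_ne[OF lim, of 0] by (auto elim!: eventually_mono simp: field_simps)
  ultimately have "(\<lambda>u. - (inverse (r u) - 1)) \<in> O[F](e)"
    by (rule landau_o.big.in_cong[THEN iffD1, rotated])
  then show "(\<lambda>u. inverse (r u) - 1) \<in> O[F](e)"
    by (subst (asm) landau_o.big.uminus_in_iff)
qed

theorem theorem1:
  fixes A \<rho> :: real and g y h \<zeta> \<psi> L :: "real \<Rightarrow> real"
  assumes "A < 0"
    and "cdf_up_to A g"
    and "\<forall>x\<le>A. 0 < g x"
    and "continuous_on {..A} g"
    and "strict_mono_on {..A} g"
    and "filterlim y at_bot (at_right 0)"
    and "(\<lambda>x. y (g x) / x - 1) \<in> O[at_bot](\<zeta>)"
    and "(\<zeta> \<longlongrightarrow> 0) at_bot"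
    and "\<forall>x\<le>A. \<zeta> x = \<psi> (- 1 / x)"
    and "\<forall>w>0. \<psi> w = w powr \<rho> * L w"
    and "\<rho> \<ge> 0"
    and "slowly_varying_at_0 L"
    and "\<forall>u\<in>{0<..g A}. h u = inv_into {..A} g u"
  shows "(\<lambda>u. h u / y u - 1) \<in> O[at_right 0](\<lambda>u. \<zeta> (y u))"
proof -
  let ?inv = "inv_into {..A} g"
  note g_lim = cdf_up_to_tendsto_0[OF assms(2)]
  have inv: "eventually (\<lambda>u. g (?inv u) = u) (at_right 0)" "filterlim ?inv at_bot (at_right 0)"
    using strict_mono_inverse_at_bot[OF g_lim _ assms(4,5)] assms(3) by auto
  have "eventually (\<lambda>u. u \<in> {0<..g A}) (at_right 0)"
    using assms(3) unfolding eventually_at_right_field by (intro exI[of _ "g A"]) auto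
  then have h_eq: "eventually (\<lambda>u. ?inv u = h u) (at_right 0)"
    by eventually_elim (simp add: assms(13))
  have h_lim: "filterlim h at_bot (at_right 0)"
    using inv(2) by (subst (asm) filterlim_cong[OF refl refl h_eq])
  have g_h: "eventually (\<lambda>u. g (h u) = u) (at_right 0)"
    using inv(1) h_eq by eventually_elim simp

  have "(\<lambda>u. y (g (h u)) / h u - 1) \<in> O[at_right 0](\<lambda>u. \<zeta> (h u))"
    using landau_o.big.compose[OF assms(7) h_lim] .
  moreover have "eventually (\<lambda>u. y (g (h u)) / h u - 1 = y u / h u - 1) (at_right 0)"
    using g_h by eventually_elim simp
  ultimately have y_h: "(\<lambda>u. y u / h u - 1) \<in> O[at_right 0](\<lambda>u. \<zeta> (h u))"
    by (rule landau_o.big.in_cong[THEN iffD1, rotated])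
  have \<zeta>_h: "((\<lambda>u. \<zeta> (h u)) \<longlongrightarrow> 0) (at_right 0)"
    using assms(8) h_lim by (rule filterlim_compose)
  have ratio: "((\<lambda>u. y u / h u) \<longlongrightarrow> 1) (at_right 0)"
    using bigo_reciprocal_minus_1(1)[OF y_h \<zeta>_h] .

  have \<psi>_bound: "(\<lambda>u. \<psi> (- 1 / h u)) \<in> O[at_right 0](\<lambda>u. \<psi> (- 1 / y u))"
    using assms(10) by (intro regularly_varying_asymp_equiv_bigo[OF assms(12,11) _ assms(6) ratio]) auto
  have \<psi>_\<zeta>: "eventually (\<lambda>u. \<psi> (- 1 / z u) = \<zeta> (z u)) (at_right 0)"
    if "filterlim z at_bot (at_right 0)" for z
  proof -
    have "eventually (\<lambda>u. z u \<le> A) (at_right 0)"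
      using that by (simp add: filterlim_at_bot)
    then show ?thesis by eventually_elim (simp add: assms(9))
  qed
  have "(\<lambda>u. \<zeta> (h u)) \<in> O[at_right 0](\<lambda>u. \<zeta> (y u))"
    using \<psi>_bound
    unfolding landau_o.big.in_cong[OF \<psi>_\<zeta>[OF h_lim]] landau_o.big.cong[OF \<psi>_\<zeta>[OF assms(6)]] .
  with bigo_reciprocal_minus_1(2)[OF y_h \<zeta>_h]
  have "(\<lambda>u. inverse (y u / h u) - 1) \<in> O[at_right 0](\<lambda>u. \<zeta> (y u))"
    by (rule landau_o.big_trans)
  then show ?thesis by simp
qed

end
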